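(* For every integer $n\ge 1$, $$|RAI_{2n}(2431,4132)|=|RAI_{2n}(3241,4213)|=|RAI_{2n+1}(3241,4213)|=|AI_{2n+1}(2431,4132)|=2^{n-1}.$$
   Context: Let $S_n$ be the set of permutations $\pi=\pi_1\ldots\pi_n$ of $\{1,\ldots,n\}$. A permutation is alternating if, for all $1\le i\le n-1$, $\pi_i<\pi_{i+1}$ if and only if $i$ is odd; it is reverse alternating if, for all $1\le i\le n-1$, $\pi_i>\pi_{i+1}$ if and only if $i$ is odd. $AI_n$ (resp. $RAI_n$) is the set of alternating (resp. reverse alternating) involutions ($\pi=\pi^{-1}$) in $S_n$. A permutation $\pi\in S_n$ avoids the pattern $\tau\in S_k$ if there are no indices $i_1<\cdots<i_k$ such that $\pi_{i_1}\ldots\pi_{i_k}$ is order-isomorphic to $\tau$; $AI_n(\sigma,\tau)$ and $RAI_n(\sigma,\tau)$ are the subsets of elements avoiding both $\sigma$ and $\tau$. (Since $4132=2431^{-1}$ and $4213=3241^{-1}$, for involutions avoiding both patterns of a pair is the same as avoiding either one.) *)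

theory Defs
  imports "HOL-Combinatorics.Permutations"
begin

(* A permutation of {1..n} is a function p :: nat => nat with p permutes {1..n} (so p is the
   identity outside {1..n}); its one-line notation is p 1, p 2, ..., p n. *)

definition alternating :: "nat \<Rightarrow> (nat \<Rightarrow> nat) \<Rightarrow> bool" where
  "alternating n p \<longleftrightarrow> (\<forall>i. 1 \<le> i \<and> i < n \<longrightarrow> (p i < p (i + 1) \<longleftrightarrow> odd i))"

definition reverse_alternating :: "nat \<Rightarrow> (nat \<Rightarrow> nat) \<Rightarrow> bool" where
  "reverse_alternating n p \<longleftrightarrow> (\<forall>i. 1 \<le> i \<and> i < n \<longrightarrow> (p i > p (i + 1) \<longleftrightarrow> odd i))"

(* A pattern is given by its one-line notation as a list. List positions start at 0, so an
   occurrence is an increasing choice of positions f 0 < ... < f (k - 1) in {1..n}. *)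
definition avoids :: "nat \<Rightarrow> (nat \<Rightarrow> nat) \<Rightarrow> nat list \<Rightarrow> bool" where
  "avoids n p \<tau> \<longleftrightarrow>
     \<not> (\<exists>f :: nat \<Rightarrow> nat.
          strict_mono_on {..<length \<tau>} f \<and> f ` {..<length \<tau>} \<subseteq> {1..n} \<and>
          (\<forall>a < length \<tau>. \<forall>b < length \<tau>. p (f a) < p (f b) \<longleftrightarrow> \<tau> ! a < \<tau> ! b))"

definition AI :: "nat \<Rightarrow> (nat \<Rightarrow> nat) set" where
  "AI n = {p. p permutes {1..n} \<and> p = inv p \<and> alternating n p}"

definition RAI :: "nat \<Rightarrow> (nat \<Rightarrow> nat) set" where
  "RAI n = {p. p permutes {1..n} \<and> p = inv p \<and> reverse_alternating n p}"

definition AI_avoiding :: "nat \<Rightarrow> nat list \<Rightarrow> nat list \<Rightarrow> (nat \<Rightarrow> nat) set" where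
  "AI_avoiding n \<sigma> \<tau> = {p \<in> AI n. avoids n p \<sigma> \<and> avoids n p \<tau>}"

definition RAI_avoiding :: "nat \<Rightarrow> nat list \<Rightarrow> nat list \<Rightarrow> (nat \<Rightarrow> nat) set" where
  "RAI_avoiding n \<sigma> \<tau> = {p \<in> RAI n. avoids n p \<sigma> \<and> avoids n p \<tau>}"

end

theory Submission
  imports Defs
begin

text \<open>
  The patterns 3241 and 4213 are inverse to each other, so for involutions one of them suffices.
  If \<open>p\<close> is a reverse alternating involution avoiding 3241 and \<open>p 1 = m\<close>, then \<open>p m = 1\<close> forces
  \<open>m = 2 k\<close>; an entry larger than \<open>m\<close> before position \<open>m\<close> would form 3241 together with \<open>m\<close>,
  \<open>p 2\<close> and the final 1, so \<open>p\<close> maps \<open>{1..m}\<close> to itself. Inside this block the entries between \<open>m\<close>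
  and 1 avoid 213, and for an alternating involution of even length this leaves one possibility: the
  maximum sits in position 2, and one peels off positions 1, 2 and the last two, repeatedly.
  Hence \<open>p\<close> is a direct sum of such rigid blocks (and possibly a fixed point at the end), so these
  involutions correspond to compositions of \<open>n\<close>. Since 3241 and 4213 are sum-indecomposable, all
  such sums do avoid them. Reverse-complement reduces the pair 2431, 4132 to this case.
\<close>

section \<open>Involutions and pattern conditions with explicit positions\<close>

definition no3241 :: "nat \<Rightarrow> (nat \<Rightarrow> nat) \<Rightarrow> bool" where
  "no3241 n p \<longleftrightarrow> \<not> (\<exists>i j k l. 1 \<le> i \<and> i < j \<and> j < k \<and> k < l \<and> l \<le> n \<and>
     p l < p j \<and> p j < p i \<and> p i < p k)"

definition no4132 :: "nat \<Rightarrow> (nat \<Rightarrow> nat) \<Rightarrow> bool" where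
  "no4132 n p \<longleftrightarrow> \<not> (\<exists>i j k l. 1 \<le> i \<and> i < j \<and> j < k \<and> k < l \<and> l \<le> n \<and>
     p j < p l \<and> p l < p k \<and> p k < p i)"

text \<open>The involution law is stated for every natural number, so rewriting with it later needs
  no range conditions.\<close>

definition invol_on :: "nat \<Rightarrow> (nat \<Rightarrow> nat) \<Rightarrow> bool" where
  "invol_on n p \<longleftrightarrow> (\<forall>i. p (p i) = i) \<and> (\<forall>i. i = 0 \<or> n < i \<longrightarrow> p i = i)"

lemma invol_on_iff: "p permutes {1..n} \<and> p = inv p \<longleftrightarrow> invol_on n p"
proof
  assume *: "p permutes {1..n} \<and> p = inv p"
  then have "p (p i) = i" for i
    using permutes_inverses(1)[of p "{1..n}" i] by metis
  moreover have "p i = i" if "i = 0 \<or> n < i" for i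
    using * that by (intro permutes_not_in[of p "{1..n}"]) auto
  ultimately show "invol_on n p"
    unfolding invol_on_def by blast
next
  assume p: "invol_on n p"
  then have pp: "p \<circ> p = id" by (auto simp: invol_on_def)
  have "p permutes {1..n}"
    using p unfolding permutes_def invol_on_def by (metis atLeastAtMost_iff less_one not_le)
  moreover have "p = inv p" using inv_unique_comp[OF pp pp] by simp
  ultimately show "p permutes {1..n} \<and> p = inv p" by blast
qed

lemma invol_on_range:
  assumes "invol_on n p" "1 \<le> i" "i \<le> n"
  shows "1 \<le> p i" "p i \<le> n"
  using assms unfolding invol_on_def
  by (metis One_nat_def Suc_leI bot_nat_0.not_eq_extremum not_one_le_zero, metis not_le)

lemma invol_on_inj: "invol_on n p \<Longrightarrow> p i = p j \<longleftrightarrow> i = j"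
  by (metis invol_on_def)

text \<open>Trades the embedding \<open>f\<close> for four positions. The converse may use
  \<open>[i, j, k, l] ! x\<close> as embedding, since only arguments below 4 count. For a concrete
  pattern, \<open>all_less_4\<close> then evaluates the comparisons.\<close>

lemma avoids_four:
  "avoids n p [a, b, c, d] \<longleftrightarrow> \<not> (\<exists>i j k l. 1 \<le> i \<and> i < j \<and> j < k \<and> k < l \<and> l \<le> n \<and>
     (\<forall>x<4. \<forall>y<4. p ([i, j, k, l] ! x) < p ([i, j, k, l] ! y) \<longleftrightarrow> [a, b, c, d] ! x < [a, b, c, d] ! y))"
  (is "_ \<longleftrightarrow> \<not> ?R")
proof -
  have lt4: "{..<4::nat} = {0, 1, 2, 3}" by auto
  have len: "length [a, b, c, d] = 4" by simp
  have "?R" if f: "strict_mono_on {..<4} f" "f ` {..<4} \<subseteq> {1..n}"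
      "\<forall>x<4. \<forall>y<4. p (f x) < p (f y) \<longleftrightarrow> [a, b, c, d] ! x < [a, b, c, d] ! y" for f
  proof -
    have "f 0 < f 1" "f 1 < f 2" "f 2 < f 3"
      using f(1) by (auto simp: strict_mono_on_def)
    moreover have "1 \<le> f 0" "f 3 \<le> n" using f(2) by (auto simp: lt4)
    moreover have "[f 0, f 1, f 2, f 3] ! x = f x" if "x < 4" for x
      using that by (auto simp: numeral_eq_Suc less_Suc_eq)
    ultimately show ?R using f(3)
      by (intro exI[of _ "f 0"] exI[of _ "f 1"] exI[of _ "f 2"] exI[of _ "f 3"]) simp
  qed
  moreover have "\<exists>f. strict_mono_on {..<4} f \<and> f ` {..<4} \<subseteq> {1..n} \<and>
      (\<forall>x<4. \<forall>y<4. p (f x) < p (f y) \<longleftrightarrow> [a, b, c, d] ! x < [a, b, c, d] ! y)" if ?R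
  proof -
    from that obtain i j k l where *: "1 \<le> i" "i < j" "j < k" "k < l" "l \<le> n"
      "\<forall>x<4. \<forall>y<4. p ([i, j, k, l] ! x) < p ([i, j, k, l] ! y) \<longleftrightarrow> [a, b, c, d] ! x < [a, b, c, d] ! y"
      by blast
    show ?thesis
      using * by (intro exI[of _ "\<lambda>x. [i, j, k, l] ! x"])
        (auto simp: strict_mono_on_def lt4)
  qed
  ultimately show ?thesis
    unfolding avoids_def len by (intro arg_cong[where f = Not] iffI) (elim exE conjE, blast, blast)
qed

lemma all_less_4: "(\<forall>x<4. P x) \<longleftrightarrow> P 0 \<and> P 1 \<and> P 2 \<and> P (3::nat)"
  by (auto simp: numeral_eq_Suc less_Suc_eq)

lemma avoids_3241: "avoids n p [3, 2, 4, 1] \<longleftrightarrow> no3241 n p"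
proof -
  have *: "(\<forall>x<4. \<forall>y<4. p ([i, j, k, l] ! x) < p ([i, j, k, l] ! y) \<longleftrightarrow>
      [3, 2, 4, 1 :: nat] ! x < [3, 2, 4, 1] ! y) \<longleftrightarrow> p l < p j \<and> p j < p i \<and> p i < p k" for i j k l
    by (auto simp: all_less_4)
  show ?thesis unfolding avoids_four no3241_def * ..
qed

lemma avoids_4132: "avoids n p [4, 1, 3, 2] \<longleftrightarrow> no4132 n p"
proof -
  have *: "(\<forall>x<4. \<forall>y<4. p ([i, j, k, l] ! x) < p ([i, j, k, l] ! y) \<longleftrightarrow>
      [4, 1, 3, 2 :: nat] ! x < [4, 1, 3, 2] ! y) \<longleftrightarrow> p j < p l \<and> p l < p k \<and> p k < p i" for i j k l
    by (auto simp: all_less_4)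
  show ?thesis unfolding avoids_four no4132_def * ..
qed

text \<open>Inverting an occurrence of 4213 at i < j < k < l gives positions
  \<open>p k < p j < p l < p i\<close> with values k, j, l, i, which is a 3241.\<close>

lemma avoids_4213:
  assumes p: "invol_on n p" and "no3241 n p"
  shows "avoids n p [4, 2, 1, 3]"
  unfolding avoids_four
proof (safe)
  fix i j k l
  assume ord: "1 \<le> i" "i < j" "j < k" "k < l" "l \<le> n"
    and pat: "\<forall>x<4. \<forall>y<4. (p ([i, j, k, l] ! x) < p ([i, j, k, l] ! y)) =
           ([4, 2, 1, 3 :: nat] ! x < [4, 2, 1, 3] ! y)"
  from pat have "p k < p j" "p j < p l" "p l < p i"
    by (auto simp: all_less_4)
  moreover have "p (p i) < p (p j)" "p (p j) < p (p k)" "p (p k) < p (p l)"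
    using p ord by (simp_all add: invol_on_def)
  moreover have "1 \<le> p k" "p i \<le> n" using invol_on_range[OF p] ord by simp_all
  ultimately show False using assms(2) unfolding no3241_def by blast
qed

text \<open>Inverting a 2431 gives positions \<open>p l < p i < p k < p j\<close> with values l, i,
  k, j, which is a 4132.\<close>

lemma avoids_2431:
  assumes p: "invol_on n p" and "no4132 n p"
  shows "avoids n p [2, 4, 3, 1]"
  unfolding avoids_four
proof (safe)
  fix i j k l
  assume ord: "1 \<le> i" "i < j" "j < k" "k < l" "l \<le> n"
    and pat: "\<forall>x<4. \<forall>y<4. (p ([i, j, k, l] ! x) < p ([i, j, k, l] ! y)) =
           ([2, 4, 3, 1 :: nat] ! x < [2, 4, 3, 1] ! y)"
  from pat have "p l < p i" "p i < p k" "p k < p j"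
    by (auto simp: all_less_4)
  moreover have "p (p i) < p (p j)" "p (p j) < p (p k)" "p (p k) < p (p l)"
    using p ord by (simp_all add: invol_on_def)
  moreover have "1 \<le> p l" "p j \<le> n" using invol_on_range[OF p] ord by simp_all
  ultimately show False using assms(2) unfolding no4132_def by blast
qed

definition R3241 :: "nat \<Rightarrow> (nat \<Rightarrow> nat) set" where
  "R3241 n = {p. invol_on n p \<and> reverse_alternating n p \<and> no3241 n p}"

lemma RAI_avoiding_3241: "RAI_avoiding n [3, 2, 4, 1] [4, 2, 1, 3] = R3241 n"
  unfolding RAI_avoiding_def RAI_def R3241_def avoids_3241
  using invol_on_iff avoids_4213 by blast

text \<open>
  The parity of \<open>n - i\<close> makes this the reverse-complement of \<open>R3241 n\<close> for both parities of \<open>n\<close>: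
  it is reverse alternating for even \<open>n\<close> and alternating for odd \<open>n\<close>.
\<close>

definition X4132 :: "nat \<Rightarrow> (nat \<Rightarrow> nat) set" where
  "X4132 n = {p. invol_on n p \<and> no4132 n p \<and>
     (\<forall>i. 1 \<le> i \<and> i < n \<longrightarrow> (p i > p (i + 1) \<longleftrightarrow> odd (n - i)))}"

lemma RAI_avoiding_4132: "RAI_avoiding (2 * n) [2, 4, 3, 1] [4, 1, 3, 2] = X4132 (2 * n)"
proof -
  have "reverse_alternating (2 * n) p \<longleftrightarrow>
     (\<forall>i. 1 \<le> i \<and> i < 2 * n \<longrightarrow> (p i > p (i + 1) \<longleftrightarrow> odd (2 * n - i)))" for p
    by (auto simp: reverse_alternating_def)
  then show ?thesis
    unfolding RAI_avoiding_def RAI_def X4132_def avoids_4132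
    using invol_on_iff avoids_2431 by blast
qed

lemma AI_avoiding_4132: "AI_avoiding (2 * n + 1) [2, 4, 3, 1] [4, 1, 3, 2] = X4132 (2 * n + 1)"
proof -
  have "alternating (2 * n + 1) p \<longleftrightarrow>
     (\<forall>i. 1 \<le> i \<and> i < 2 * n + 1 \<longrightarrow> (p i > p (i + 1) \<longleftrightarrow> odd (2 * n + 1 - i)))"
    if "invol_on (2 * n + 1) p" for p
  proof -
    \<comment> \<open>\<open>alternating\<close> speaks of ascents and \<open>X4132\<close> of
      descents; they are complementary because neighbours differ.\<close>
    have "p i \<noteq> p (i + 1)" for i using invol_on_inj[OF that] by simp
    then have "p i < p (i + 1) \<longleftrightarrow> \<not> p i > p (i + 1)" for i
      using linorder_less_linear not_less_iff_gr_or_eq by blast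
    then show ?thesis unfolding alternating_def by auto
  qed
  then show ?thesis
    unfolding AI_avoiding_def AI_def X4132_def avoids_4132
    using invol_on_iff avoids_2431 by blast
qed

section \<open>Reverse-complement\<close>

definition rev_compl :: "nat \<Rightarrow> (nat \<Rightarrow> nat) \<Rightarrow> nat \<Rightarrow> nat" where
  "rev_compl n p i = (if 1 \<le> i \<and> i \<le> n then n + 1 - p (n + 1 - i) else i)"

lemma invol_on_rev_compl:
  assumes p: "invol_on n p"
  shows "invol_on n (rev_compl n p)"
proof -
  have "rev_compl n p (rev_compl n p i) = i" for i
  proof (cases "1 \<le> i \<and> i \<le> n")
    case True
    then have "1 \<le> p (n + 1 - i)" "p (n + 1 - i) \<le> n"
      using invol_on_range[OF p, of "n + 1 - i"] by auto
    moreover have "p (p x) = x" for x using p by (simp add: invol_on_def)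
    ultimately show ?thesis using True by (auto simp: rev_compl_def)
  qed (auto simp: rev_compl_def)
  then show ?thesis by (auto simp: invol_on_def rev_compl_def)
qed

lemma rev_compl_rev_compl:
  assumes p: "invol_on n p"
  shows "rev_compl n (rev_compl n p) = p"
proof
  fix i
  show "rev_compl n (rev_compl n p) i = p i"
  proof (cases "1 \<le> i \<and> i \<le> n")
    case True
    then show ?thesis using invol_on_range[OF p, of i] by (auto simp: rev_compl_def)
  next
    case False
    then show ?thesis using p by (cases "i = 0") (auto simp: rev_compl_def invol_on_def)
  qed
qed

text \<open>Values are at most \<open>n\<close>, so the truncated subtraction in
  \<open>rev_compl\<close> loses nothing and reverses order.\<close>

lemma rev_compl_less_iff:
  assumes p: "invol_on n p" and "1 \<le> i" "i \<le> n" "1 \<le> j" "j \<le> n"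
  shows "rev_compl n p i < rev_compl n p j \<longleftrightarrow> p (n + 1 - j) < p (n + 1 - i)"
proof -
  have "p (n + 1 - i) \<le> n" "p (n + 1 - j) \<le> n"
    using assms invol_on_range(2)[OF p] by simp_all
  then show ?thesis using assms(2-5) unfolding rev_compl_def by simp linarith
qed

text \<open>Reversing 3241 gives 1423, whose complement is 4132. A descent of
  \<open>rev_compl n p\<close> at \<open>i\<close> is a descent of \<open>p\<close> at
  \<open>n - i\<close>, which explains the parity in \<open>X4132\<close>.\<close>

lemma rev_compl_X4132:
  assumes "p \<in> X4132 n"
  shows "rev_compl n p \<in> R3241 n"
proof -
  have p: "invol_on n p" and av: "no4132 n p"
    and alt: "\<And>i. 1 \<le> i \<Longrightarrow> i < n \<Longrightarrow> p i > p (i + 1) \<longleftrightarrow> odd (n - i)"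
    using assms by (auto simp: X4132_def)
  have "no3241 n (rev_compl n p)"
    unfolding no3241_def
  proof safe
    fix i j k l
    assume *: "1 \<le> i" "i < j" "j < k" "k < l" "l \<le> n"
      "rev_compl n p l < rev_compl n p j" "rev_compl n p j < rev_compl n p i"
      "rev_compl n p i < rev_compl n p k"
    have "p (n + 1 - k) < p (n + 1 - i)" "p (n + 1 - i) < p (n + 1 - j)"
        "p (n + 1 - j) < p (n + 1 - l)"
      using * rev_compl_less_iff[OF p, of i k] rev_compl_less_iff[OF p, of j i]
        rev_compl_less_iff[OF p, of l j] by simp_all
    moreover have "1 \<le> n + 1 - l" "n + 1 - l < n + 1 - k" "n + 1 - k < n + 1 - j"
      "n + 1 - j < n + 1 - i" "n + 1 - i \<le> n" using * by auto
    ultimately show False using av unfolding no4132_def by blast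
  qed
  moreover have "reverse_alternating n (rev_compl n p)"
    unfolding reverse_alternating_def
  proof (intro allI impI)
    fix i assume "1 \<le> i \<and> i < n"
    then have i: "1 \<le> i" "i < n" by auto
    have "rev_compl n p (i + 1) < rev_compl n p i \<longleftrightarrow> p (n - i + 1) < p (n - i)"
      using i rev_compl_less_iff[OF p, of "i + 1" i] by (simp add: Suc_diff_le)
    also have "\<dots> \<longleftrightarrow> odd i" using alt[of "n - i"] i by simp
    finally show "rev_compl n p (i + 1) < rev_compl n p i \<longleftrightarrow> odd i" .
  qed
  ultimately show ?thesis using invol_on_rev_compl[OF p] by (simp add: R3241_def)
qed

lemma rev_compl_R3241:
  assumes "p \<in> R3241 n"
  shows "rev_compl n p \<in> X4132 n"
proof -
  have p: "invol_on n p" and av: "no3241 n p"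
    and alt: "\<And>i. 1 \<le> i \<Longrightarrow> i < n \<Longrightarrow> p i > p (i + 1) \<longleftrightarrow> odd i"
    using assms by (auto simp: R3241_def reverse_alternating_def)
  have "no4132 n (rev_compl n p)"
    unfolding no4132_def
  proof safe
    fix i j k l
    assume *: "1 \<le> i" "i < j" "j < k" "k < l" "l \<le> n"
      "rev_compl n p j < rev_compl n p l" "rev_compl n p l < rev_compl n p k"
      "rev_compl n p k < rev_compl n p i"
    have "p (n + 1 - i) < p (n + 1 - k)" "p (n + 1 - k) < p (n + 1 - l)"
        "p (n + 1 - l) < p (n + 1 - j)"
      using * rev_compl_less_iff[OF p, of k i] rev_compl_less_iff[OF p, of l k]
        rev_compl_less_iff[OF p, of j l] by simp_all
    moreover have "1 \<le> n + 1 - l" "n + 1 - l < n + 1 - k" "n + 1 - k < n + 1 - j"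
      "n + 1 - j < n + 1 - i" "n + 1 - i \<le> n" using * by auto
    ultimately show False using av unfolding no3241_def by blast
  qed
  moreover have "rev_compl n p (i + 1) < rev_compl n p i \<longleftrightarrow> odd (n - i)"
    if i: "1 \<le> i" "i < n" for i
  proof -
    have "rev_compl n p (i + 1) < rev_compl n p i \<longleftrightarrow> p (n - i + 1) < p (n - i)"
      using i rev_compl_less_iff[OF p, of "i + 1" i] by (simp add: Suc_diff_le)
    also have "\<dots> \<longleftrightarrow> odd (n - i)" using alt[of "n - i"] i by simp
    finally show ?thesis .
  qed
  ultimately show ?thesis using invol_on_rev_compl[OF p] by (simp add: X4132_def)
qed

lemma card_X4132: "card (X4132 n) = card (R3241 n)"
proof (rule bij_betw_same_card)
  show "bij_betw (rev_compl n) (X4132 n) (R3241 n)"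
  proof (rule bij_betw_byWitness[where f' = "rev_compl n"])
    show "\<forall>p\<in>X4132 n. rev_compl n (rev_compl n p) = p"
      by (simp add: X4132_def rev_compl_rev_compl)
    show "\<forall>p\<in>R3241 n. rev_compl n (rev_compl n p) = p"
      by (simp add: R3241_def rev_compl_rev_compl)
  qed (auto intro: rev_compl_X4132 rev_compl_R3241)
qed

section \<open>The rigid blocks\<close>

text \<open>The word is 2k, then the pairs (2k-2, 2k-1), ..., (2, 3), then 1; for k = 3 it is 6 4 5
  2 3 1. The value at 0 lets \<open>glue\<close> fix 0.\<close>

definition block :: "nat \<Rightarrow> nat \<Rightarrow> nat" where
  "block k i = (if i = 0 then 0 else if i = 1 then 2 * k else if i = 2 * k then 1
     else if even i then 2 * k - i else 2 * k + 2 - i)"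

text \<open>Positions 2j and 2j+1 form the j-th pair, and the block exchanges pair j with pair k - j
  in order. Naming j turns parity arguments into linear arithmetic.\<close>

lemma block_cases:
  assumes "1 \<le> i" "i \<le> 2 * k"
  obtains "i = 1" "block k i = 2 * k" | "i = 2 * k" "block k i = 1"
  | j where "1 \<le> j" "j < k" "i = 2 * j" "block k i = 2 * (k - j)"
  | j where "1 \<le> j" "j < k" "i = 2 * j + 1" "block k i = 2 * (k - j) + 1"
proof -
  consider "i = 1" | "i = 2 * k" | "1 < i" "i < 2 * k" "even i" | "1 < i" "i < 2 * k" "odd i"
    using assms by linarith
  then show ?thesis
  proof cases
    case 3
    then show ?thesis by (intro that(3)[of "i div 2"]) (auto simp: block_def elim!: evenE)
  next
    case 4
    then show ?thesis by (intro that(4)[of "i div 2"]) (auto simp: block_def elim!: oddE)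
  qed (use assms that in \<open>auto simp: block_def\<close>)
qed

lemma block_range:
  assumes "1 \<le> i" "i \<le> 2 * k"
  shows "1 \<le> block k i" "block k i \<le> 2 * k"
  by (rule block_cases[OF assms]; use assms in simp; fail)+

lemma block_block:
  assumes "i \<le> 2 * k"
  shows "block k (block k i) = i"
proof (cases "i = 0")
  case False
  then have "1 \<le> i" by simp
  then show ?thesis
    by (rule block_cases[OF _ assms]) (use False assms in \<open>auto simp: block_def\<close>)
qed (simp add: block_def)

text \<open>The word is a descending sequence of runs of length at most two. This excludes 3241,
  whose 3 and 4 are not adjacent.\<close>

lemma block_ascent:
  assumes "1 \<le> i" "i < j" "j \<le> 2 * k" "block k i < block k j"
  shows "j = i + 1"
proof -
  have i: "1 \<le> i" "i \<le> 2 * k" and j: "1 \<le> j" "j \<le> 2 * k" using assms by auto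
  show ?thesis
    by (rule block_cases[OF i]; rule block_cases[OF j]; use assms in simp)
qed

lemma block_alternating:
  assumes "1 \<le> i" "i < 2 * k"
  shows "block k i > block k (i + 1) \<longleftrightarrow> odd i"
  using assms by (auto simp: block_def elim!: evenE oddE)

section \<open>Direct sums of a block and a smaller involution\<close>

definition glue :: "nat \<Rightarrow> (nat \<Rightarrow> nat) \<Rightarrow> nat \<Rightarrow> nat" where
  "glue k q i = (if i \<le> 2 * k then block k i else 2 * k + q (i - 2 * k))"

lemma glue_in:
  assumes "1 \<le> k" "2 * k \<le> n" "q \<in> R3241 (n - 2 * k)"
  shows "glue k q \<in> R3241 n"
proof -
  have q: "invol_on (n - 2 * k) q" and av: "no3241 (n - 2 * k) q"
    and alt: "\<And>i. 1 \<le> i \<Longrightarrow> i < n - 2 * k \<Longrightarrow> q i > q (i + 1) \<longleftrightarrow> odd i"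
    using assms by (auto simp: R3241_def reverse_alternating_def)
  have q_pos: "0 < q i" if "0 < i" for i
    using q that unfolding invol_on_def by (metis not_gr_zero)
  \<comment> \<open>Both summands keep their own values; positivity of \<open>q\<close> keeps the
    upper values strictly above 2k.\<close>
  have low: "glue k q i \<le> 2 * k \<longleftrightarrow> i \<le> 2 * k" for i
    using block_range[of i k] q_pos[of "i - 2 * k"]
    by (cases "i = 0") (auto simp: glue_def block_def)
  have "invol_on n (glue k q)"
    unfolding invol_on_def
  proof safe
    fix i
    show "glue k q (glue k q i) = i"
    proof (cases "i \<le> 2 * k")
      case True
      then show ?thesis using low[of i] by (simp add: glue_def block_block)
    next
      case False
      then show ?thesis using low[of i] q by (simp add: glue_def invol_on_def)
    qed
  next
    show "glue k q 0 = 0" by (simp add: glue_def block_def)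
  next
    fix i assume "n < i"
    then show "glue k q i = i" using assms q by (simp add: glue_def invol_on_def)
  qed
  moreover have "reverse_alternating n (glue k q)"
    unfolding reverse_alternating_def
  proof (intro allI impI)
    fix i assume i: "1 \<le> i \<and> i < n"
    consider "i < 2 * k" | "i = 2 * k" | "2 * k < i" by linarith
    then show "glue k q (i + 1) < glue k q i \<longleftrightarrow> odd i"
    proof cases
      case 1
      then show ?thesis using block_alternating[of i k] i by (simp add: glue_def)
    next
      case 2
      then show ?thesis using low[of i] low[of "i + 1"] by simp
    next
      case 3
      then show ?thesis using alt[of "i - 2 * k"] i by (simp add: glue_def Suc_diff_le)
    qed
  qed
  moreover have "no3241 n (glue k q)"
    unfolding no3241_def
  proof safe
    fix a b c d
    assume *: "1 \<le> a" "a < b" "b < c" "c < d" "d \<le> n"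
      "glue k q d < glue k q b" "glue k q b < glue k q a" "glue k q a < glue k q c"
    show False
    \<comment> \<open>A 3241 lies in one summand: its last position is its largest position, and its
      last value is its smallest value.\<close>
    proof (cases "d \<le> 2 * k")
      case True
      then have "c = a + 1" using * by (intro block_ascent[of a c k]) (auto simp: glue_def)
      then show False using * by simp
    next
      case False
      then have "2 * k < glue k q d" using low[of d] by simp
      then have "2 * k < a" "2 * k < b" "2 * k < c" using * low[of a] low[of b] low[of c] by linarith+
      then have "1 \<le> a - 2 * k" "a - 2 * k < b - 2 * k" "b - 2 * k < c - 2 * k"
        "c - 2 * k < d - 2 * k" "d - 2 * k \<le> n - 2 * k"
        "q (d - 2 * k) < q (b - 2 * k)" "q (b - 2 * k) < q (a - 2 * k)"
        "q (a - 2 * k) < q (c - 2 * k)"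
        using * False by (auto simp: glue_def)
      then show False using av unfolding no3241_def by blast
    qed
  qed
  ultimately show ?thesis by (simp add: R3241_def)
qed

lemma glue_inj: "inj_on (glue k) (R3241 n)"
proof (rule inj_onI)
  fix q q' assume *: "q \<in> R3241 n" "q' \<in> R3241 n" "glue k q = glue k q'"
  show "q = q'"
  proof
    fix i
    show "q i = q' i"
    \<comment> \<open>\<open>glue\<close> never evaluates its argument at 0, so this value must come
      from \<open>invol_on\<close>.\<close>
    proof (cases "i = 0")
      case True
      then show ?thesis using * by (simp add: R3241_def invol_on_def)
    next
      case False
      then show ?thesis using fun_cong[OF *(3), of "i + 2 * k"] by (simp add: glue_def)
    qed
  qed
qed

section \<open>Splitting off the first block\<close>

lemma R3241_first:
  assumes "p \<in> R3241 n" "2 \<le> n"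
  obtains k where "1 \<le> k" "2 * k \<le> n" "p 1 = 2 * k" "\<And>i. i \<le> 2 * k \<Longrightarrow> p i \<le> 2 * k"
proof -
  have p: "invol_on n p" and av: "no3241 n p"
    and alt: "\<And>i. 1 \<le> i \<Longrightarrow> i < n \<Longrightarrow> p i > p (i + 1) \<longleftrightarrow> odd i"
    using assms by (auto simp: R3241_def reverse_alternating_def)
  have pp: "p (p x) = x" for x using p by (simp add: invol_on_def)
  have pos: "1 \<le> p x" if "1 \<le> x" for x
    using pp that p by (metis invol_on_def less_one not_less)
  have m: "p 1 \<le> n" "p 2 < p 1" "1 \<le> p 2"
    using invol_on_range[OF p, of 1] alt[of 1] pos[of 2] assms by (auto simp: numeral_2_eq_2)
  \<comment> \<open>The value 1 sits at position \<open>p 1\<close>, so no descent starts there. If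
    \<open>p 1\<close> is odd and the last position, then the even position before it starts a
    descent, again impossible.\<close>
  have "even (p 1)"
  proof (rule ccontr)
    assume odd: "odd (p 1)"
    show False
    proof (cases "p 1 < n")
      case True
      then show False using alt[of "p 1"] m odd pp[of 1] pos[of "p 1 + 1"] by simp
    next
      case False
      then have "p 1 = n" using m by simp
      then show False using alt[of "n - 1"] m odd pp[of 1] pp[of "n - 1"] pos[of "n - 1"] assms(2) by fastforce
    qed
  qed
  moreover have "p i \<le> p 1" if i: "i \<le> p 1" for i
  proof (rule ccontr)
    assume "\<not> p i \<le> p 1"
    then have big: "p 1 < p i" by simp
    then have "i \<noteq> 0" "i \<noteq> 1" "i \<noteq> 2" "i \<noteq> p 1"
      using m pp[of 1] p by (auto simp: invol_on_def intro!: gr0I)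
    \<comment> \<open>Otherwise \<open>p 1 = 2\<close>, and every \<open>i\<close> up to 2 is
      already excluded.\<close>
    moreover have "p 2 \<noteq> 1" using calculation i pp[of 2] by auto
    ultimately have "1 < (2::nat)" "2 < i" "i < p 1" "p (p 1) < p 2" "p 2 < p 1" "p 1 < p i"
      using i m pp[of 1] big by auto
    then show False using av m(1) unfolding no3241_def by blast
  qed
  ultimately show thesis using that[of "p 1 div 2"] m by (auto elim!: evenE)
qed

text \<open>Pairs are fixed from the outside inwards. Knowing \<open>p\<close> on pair t gives pair
  k - t by involution, so the induction \<open>main\<close> covers only 2t up to k.\<close>

lemma R3241_block:
  assumes "p \<in> R3241 n" "1 \<le> k" "2 * k \<le> n" "p 1 = 2 * k" "\<And>i. i \<le> 2 * k \<Longrightarrow> p i \<le> 2 * k"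
    and i: "i \<le> 2 * k"
  shows "p i = block k i"
proof -
  have p: "invol_on n p" and av: "no3241 n p"
    and alt: "\<And>i. 1 \<le> i \<Longrightarrow> i < n \<Longrightarrow> p i > p (i + 1) \<longleftrightarrow> odd i"
    using assms by (auto simp: R3241_def reverse_alternating_def)
  have pp: "p (p x) = x" for x using p by (simp add: invol_on_def)
  have eq: "p x = p y \<longleftrightarrow> x = y" for x y using invol_on_inj[OF p] .
  have p0: "p 0 = 0" using p by (simp add: invol_on_def)
  have p2k: "p (2 * k) = 1" using pp[of 1] assms(4) by simp
  have up: "p i < p (i + 1)" if "even i" "1 \<le> i" "i < n" for i
    using alt[of i] eq[of i "i + 1"] that by (simp add: not_less le_less)
  have main: "p (2 * t) = 2 * (k - t) \<and> p (2 * t + 1) = 2 * (k - t) + 1"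
    if "1 \<le> t" "t < k" "2 * t \<le> k" for t
    using that
  proof (induction t rule: less_induct)
    case (less t)
    \<comment> \<open>Once the outer pairs are removed, the positions 2t to \<open>M\<close>
      remain.\<close>
    define M where "M = 2 * (k - t) + 1"
    have M: "2 * t + 1 \<le> M" "M < 2 * k" using less.prems by (auto simp: M_def)
    have IH: "p (2 * s) = 2 * (k - s)" "p (2 * s + 1) = 2 * (k - s) + 1"
        "p (2 * (k - s)) = 2 * s" "p (2 * (k - s) + 1) = 2 * s + 1"
      if "1 \<le> s" "s < t" for s
      using less.IH[OF that(2)] that less.prems pp[of "2 * s"] pp[of "2 * s + 1"] by auto
    \<comment> \<open>The remaining interval is mapped to itself: each value outside it is already
      taken by a position outside. \<open>block_cases\<close> serves here only to classify the
      number \<open>p i\<close>.\<close>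
    have mid: "2 * t \<le> p i \<and> p i \<le> M" if i: "2 * t \<le> i" "i \<le> M" for i
    proof (rule ccontr)
      assume out: "\<not> (2 * t \<le> p i \<and> p i \<le> M)"
      have r: "1 \<le> p i" "p i \<le> 2 * k"
        using i M less.prems assms(5)[of i] eq[of i 0] p0 by (auto simp: not_less_eq_eq[symmetric])
      show False
      proof (rule block_cases[OF r])
        assume "p i = 1"
        then show False using p2k eq[of i "2 * k"] i M by simp
      next
        assume "p i = 2 * k"
        then show False using assms(4) eq[of i 1] i less.prems by simp
      next
        fix j assume j: "1 \<le> j" "j < k" "p i = 2 * j"
        show False
        proof (cases "j < t")
          case True
          then show False using IH(3)[of j] j eq[of i "2 * (k - j)"] i pp[of i] IH(1)[of j] by (simp add: M_def)
        next
          case False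
          then have "k - j < t" using out j by (auto simp: M_def)
          then show False using IH(3)[of "k - j"] pp[of i] j i by simp
        qed
      next
        fix j assume j: "1 \<le> j" "j < k" "p i = 2 * j + 1"
        show False
        proof (cases "j < t")
          case True
          then show False using pp[of i] IH(2)[of j] j i by (simp add: M_def)
        next
          case False
          then have "k - j < t" using out j by (auto simp: M_def)
          then show False using IH(4)[of "k - j"] pp[of i] j i by simp
        qed
      qed
    qed
    define x where "x = p M"
    have px: "p x = M" by (simp add: x_def pp)
    have x: "2 * t \<le> x" "x \<le> M" using mid[of M] M by (auto simp: x_def)
    \<comment> \<open>\<open>x\<close> is the position of the maximum \<open>M\<close> of the
      interval; an even \<open>x\<close> would be followed by a larger value inside it.\<close>
    have "odd x"
    proof
      assume "even x"
      then have "x < M" using x by (metis M_def even_add even_mult_iff even_numeral le_neq_implies_less odd_one)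
      then show False using up[of x] \<open>even x\<close> x M assms(3) mid[of "x + 1"] px less.prems by simp
    qed
    \<comment> \<open>Otherwise positions 2t+1, 2t+2, x and 2k carry a 3241, with \<open>M\<close>
      as its 4 and the final entry 1 as its 1.\<close>
    have "x = 2 * t + 1"
    proof (rule ccontr)
      assume "x \<noteq> 2 * t + 1"
      then have x3: "2 * t + 3 \<le> x" using x \<open>odd x\<close> by (auto elim!: oddE)
      have "p (2 * t + 2) < p (2 * t + 1)" using alt[of "2 * t + 1"] x3 x M assms(3) by simp
      moreover have "p (2 * t + 1) < p x"
        using mid[of "2 * t + 1"] x3 x px eq[of "2 * t + 1" x] by linarith
      moreover have "p (2 * k) < p (2 * t + 2)"
        using mid[of "2 * t + 2"] x3 x p2k less.prems by simp
      moreover have "1 \<le> 2 * t + 1" "2 * t + 1 < 2 * t + 2" "2 * t + 2 < x" "x < 2 * k"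
        using x3 x M by auto
      ultimately show False using av assms(3) unfolding no3241_def by blast
    qed
    then have 1: "p (2 * t + 1) = M" "p M = 2 * t + 1" using px x_def by auto
    \<comment> \<open>\<open>M - 1\<close> is even, so an ascent leads to
      \<open>p M = 2 * t + 1\<close>; only the lower end 2t of the interval is left for
      \<open>p (M - 1)\<close>.\<close>
    have "p (M - 1) < p M" using up[of "M - 1"] M assms(3) less.prems by (simp add: M_def)
    moreover have "2 * t \<le> p (M - 1)" using mid[of "M - 1"] M by (simp add: M_def)
    ultimately have "p (M - 1) = 2 * t" using 1 by simp
    then show ?case using 1 pp[of "M - 1"] by (simp add: M_def)
  qed
  have all: "p (2 * t) = 2 * (k - t) \<and> p (2 * t + 1) = 2 * (k - t) + 1" if "1 \<le> t" "t < k" for t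
  proof (cases "2 * t \<le> k")
    case True
    then show ?thesis using main that by blast
  next
    case False
    then have "1 \<le> k - t" "k - t < k" "2 * (k - t) \<le> k" using that by auto
    from main[OF this] show ?thesis using that pp[of "2 * (k - t)"] pp[of "2 * (k - t) + 1"] by simp
  qed
  show "p i = block k i"
  proof (cases "i = 0")
    case False
    then have "1 \<le> i" by simp
    then show ?thesis
      by (rule block_cases[OF _ i]) (use all assms p2k in auto)
  qed (simp add: p0 block_def)
qed

lemma R3241_glue:
  assumes "p \<in> R3241 n" "2 \<le> n"
  obtains k q where "1 \<le> k" "2 * k \<le> n" "q \<in> R3241 (n - 2 * k)" "p = glue k q"
proof -
  obtain k where k: "1 \<le> k" "2 * k \<le> n" "p 1 = 2 * k" "\<And>i. i \<le> 2 * k \<Longrightarrow> p i \<le> 2 * k"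
    using R3241_first[OF assms] by blast
  have p: "invol_on n p" and av: "no3241 n p"
    and alt: "\<And>i. 1 \<le> i \<Longrightarrow> i < n \<Longrightarrow> p i > p (i + 1) \<longleftrightarrow> odd i"
    using assms by (auto simp: R3241_def reverse_alternating_def)
  have pp: "p (p x) = x" for x using p by (simp add: invol_on_def)
  define q where "q i = p (i + 2 * k) - 2 * k" for i
  \<comment> \<open>If \<open>p i\<close> were at most 2k, then so would be
    \<open>p (p i) = i\<close>.\<close>
  have high: "2 * k < p i" if "2 * k < i" for i
    using k(4)[of "p i"] pp[of i] that by fastforce
  have pq: "p (i + 2 * k) = q i + 2 * k" if "0 < i" for i
    using high[of "i + 2 * k"] that by (simp add: q_def)
  \<comment> \<open>Here \<open>p (2 * k) = 1\<close>, and the subtraction truncates to 0.\<close>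
  have q0: "q 0 = 0" using pp[of 1] k by (simp add: q_def)
  have "p = glue k q"
  proof
    fix i
    show "p i = glue k q i"
      using R3241_block[OF assms(1) k, of i] pq[of "i - 2 * k"] by (simp add: glue_def)
  qed
  moreover have "q \<in> R3241 (n - 2 * k)"
  proof -
    have "invol_on (n - 2 * k) q"
      unfolding invol_on_def
    proof safe
      fix i
      show "q (q i) = i"
      proof (cases "i = 0")
        case False
        then show ?thesis using pq[of i] pp[of "i + 2 * k"] by (simp add: q_def[of "q i"])
      qed (simp add: q0)
    next
      show "q 0 = 0" by (fact q0)
    next
      fix i assume "n - 2 * k < i"
      then show "q i = i" using p k by (simp add: q_def invol_on_def)
    qed
    moreover have "reverse_alternating (n - 2 * k) q"
      unfolding reverse_alternating_def
    proof (intro allI impI)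
      fix i assume "1 \<le> i \<and> i < n - 2 * k"
      then show "q (i + 1) < q i \<longleftrightarrow> odd i"
        using alt[of "i + 2 * k"] pq[of i] pq[of "i + 1"] by (simp add: less_diff_conv)
    qed
    moreover have "no3241 (n - 2 * k) q"
      unfolding no3241_def
    proof safe
      fix a b c d
      assume *: "1 \<le> a" "a < b" "b < c" "c < d" "d \<le> n - 2 * k"
        "q d < q b" "q b < q a" "q a < q c"
      then have "1 \<le> a + 2 * k" "a + 2 * k < b + 2 * k" "b + 2 * k < c + 2 * k"
        "c + 2 * k < d + 2 * k" "d + 2 * k \<le> n"
        "p (d + 2 * k) < p (b + 2 * k)" "p (b + 2 * k) < p (a + 2 * k)"
        "p (a + 2 * k) < p (c + 2 * k)"
        using pq[of a] pq[of b] pq[of c] pq[of d] k by auto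
      then show False using av unfolding no3241_def by blast
    qed
    ultimately show ?thesis by (simp add: R3241_def)
  qed
  ultimately show thesis using that k by blast
qed

section \<open>Counting by the size of the first block\<close>

lemma R3241_small:
  assumes "n \<le> 1"
  shows "R3241 n = {id}"
proof -
  have "p = id" if "invol_on n p" for p
  proof
    fix i
    show "p i = id i"
      using that invol_on_range[OF that, of i] assms
      by (cases "i = 0 \<or> n < i") (auto simp: invol_on_def)
  qed
  then show ?thesis using assms
    by (auto simp: R3241_def invol_on_def reverse_alternating_def no3241_def)
qed

lemma finite_R3241: "finite (R3241 n)"
proof (rule finite_subset)
  show "R3241 n \<subseteq> {p. p permutes {1..n}}" using invol_on_iff by (auto simp: R3241_def)
  show "finite {p. p permutes {1..n}}" by (simp add: finite_permutations)
qed

lemma card_R3241_rec: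
  assumes "2 \<le> n"
  shows "card (R3241 n) = (\<Sum>k\<in>{1..n div 2}. card (R3241 (n - 2 * k)))"
proof -
  have "R3241 n = (\<Union>k\<in>{1..n div 2}. glue k ` R3241 (n - 2 * k))"
  proof (intro equalityI subsetI)
    fix p assume "p \<in> R3241 n"
    then obtain k q where "1 \<le> k" "2 * k \<le> n" "q \<in> R3241 (n - 2 * k)" "p = glue k q"
      using R3241_glue[OF _ assms] by blast
    then show "p \<in> (\<Union>k\<in>{1..n div 2}. glue k ` R3241 (n - 2 * k))"
      by (intro UN_I[of k]) auto
  qed (auto intro!: glue_in)
  also have "card \<dots> = (\<Sum>k\<in>{1..n div 2}. card (glue k ` R3241 (n - 2 * k)))"
  proof (rule card_UN_disjoint)
    show "\<forall>k\<in>{1..n div 2}. finite (glue k ` R3241 (n - 2 * k))"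
      by (simp add: finite_R3241)
    \<comment> \<open>The first entry of \<open>glue k q\<close> is 2k, so it determines the
      block.\<close>
    have "k = l" if "glue k q = glue l r" "1 \<le> k" "1 \<le> l" for k l q r
      using fun_cong[OF that(1), of 1] that(2,3) by (simp add: glue_def block_def)
    then show "\<forall>k\<in>{1..n div 2}. \<forall>l\<in>{1..n div 2}. k \<noteq> l \<longrightarrow>
        glue k ` R3241 (n - 2 * k) \<inter> glue l ` R3241 (n - 2 * l) = {}"
      by fastforce
  qed simp
  also have "\<dots> = (\<Sum>k\<in>{1..n div 2}. card (R3241 (n - 2 * k)))"
    by (intro sum.cong refl card_image glue_inj)
  finally show ?thesis .
qed

text \<open>\<open>e\<close> is the parity of the length. By truncation the formula gives 1 at n =
  0, matching the identity alone; this extra 1 completes 1 + 2 + ... + 2^(m-1) to 2^m in the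
  recursion.\<close>

lemma card_R3241:
  assumes "e \<le> 1"
  shows "card (R3241 (2 * n + e)) = 2 ^ (n - 1)"
proof (induction n rule: less_induct)
  case (less n)
  show ?case
  proof (cases n)
    case 0
    then show ?thesis using R3241_small[OF assms] by simp
  next
    case (Suc m)
    have half: "(2 * n + e) div 2 = n" using assms by simp
    have "card (R3241 (2 * n + e)) = (\<Sum>k\<in>{1..n}. card (R3241 (2 * n + e - 2 * k)))"
      using card_R3241_rec[of "2 * n + e"] Suc unfolding half by simp
    also have "\<dots> = (\<Sum>j<n. card (R3241 (2 * j + e)))"
      by (rule sum.reindex_bij_witness[of _ "\<lambda>j. n - j" "\<lambda>k. n - k"])
        (auto simp: diff_mult_distrib2)
    also have "\<dots> = (\<Sum>j<Suc m. 2 ^ (j - 1))"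
      unfolding Suc by (intro sum.cong refl less.IH) (simp add: Suc)
    also have "\<dots> = 2 ^ m"
      by (induction m) auto
    finally show ?thesis using Suc by simp
  qed
qed

theorem theorem9p1:
  fixes n :: nat
  assumes "n \<ge> 1"
  shows "card (RAI_avoiding (2 * n) [2, 4, 3, 1] [4, 1, 3, 2]) = 2 ^ (n - 1) \<and>
         card (RAI_avoiding (2 * n) [3, 2, 4, 1] [4, 2, 1, 3]) = 2 ^ (n - 1) \<and>
         card (RAI_avoiding (2 * n + 1) [3, 2, 4, 1] [4, 2, 1, 3]) = 2 ^ (n - 1) \<and>
         card (AI_avoiding (2 * n + 1) [2, 4, 3, 1] [4, 1, 3, 2]) = 2 ^ (n - 1)"
  unfolding RAI_avoiding_4132 RAI_avoiding_3241 AI_avoiding_4132 card_X4132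
  using card_R3241[of 0 n] card_R3241[of 1 n] by simp

end
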